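(* Let $m$ be a positive integer. In each of the following cases the displayed identity holds, and the triple consisting of $n_1=6m+6$ and the denominators $n_2,n_3$ of the second and third unit fractions on the right-hand side is a wild solution of the Erdős–Straus equation for $24m+1$. (1) If $m=46r+14+c(46r+15)$ with $r,c\in\mathbb N$, then $$\frac{4}{24m+1}=\frac{1}{6m+6}+\frac{1}{4(3r+1)(c+1)(24m+1)}+\frac{1}{12(3r+1)(c+1)(46r+15)(24m+1)}.$$ (2) If $m=138r-2+c(138r-1)$ with $r\in\mathbb N$, $r>0$, $c\in\mathbb N$, then $$\frac{4}{24m+1}=\frac{1}{6m+6}+\frac{1}{36r(c+1)(24m+1)}+\frac{1}{36r(c+1)(138r-1)(24m+1)}.$$ (3) If $m=138r+90+c(138r+91)$ with $r,c\in\mathbb N$, then $$\frac{4}{24m+1}=\frac{1}{6m+6}+\frac{1}{12(3r+2)(c+1)(24m+1)}+\frac{1}{12(3r+2)(c+1)(138r+91)(24m+1)}.$$ (4) If $m=138r+42+c(138r+43)$ with $r,c\in\mathbb N$, then $$\frac{4}{24m+1}=\frac{1}{6m+6}+\frac{1}{12(3r+1)(c+1)(24m+1)}+\frac{1}{4(3r+1)(c+1)(138r+43)(24m+1)}.$$ (5) If $m=138r+88+c(138r+89)$ with $r,c\in\mathbb N$, then $$\frac{4}{24m+1}=\frac{1}{6m+6}+\frac{1}{12(3r+2)(c+1)(24m+1)}+\frac{1}{4(3r+2)(c+1)(138r+89)(24m+1)}.$$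
   Context: $\mathbb N$ denotes the set of nonnegative integers. For a positive integer $m$, the Erdős–Straus equation for $n=24m+1$ is $\frac{4}{n}=\frac1{n_1}+\frac1{n_2}+\frac1{n_3}$ in positive integers $n_1,n_2,n_3$. For $n_1=6m+k$ with $1\le k\le 12m$ one has $\frac{4}{24m+1}=\frac{1}{6m+k}+\frac{4k-1}{(6m+k)(24m+1)}$. A solution $(n_1,n_2,n_3)$ is called a wild solution if $n_1=6m+k$ for some integer $1\le k\le 12m$ and there exist an integer $L\ge 2$ (called a multiplier) and positive integers $J_1,J_2$ (called the numerator summands) such that $J_1+J_2=L(4k-1)$, $\gcd(L,J_1,J_2)=1$, $\frac1{n_2}=\frac{J_1}{L(6m+k)(24m+1)}$ and $\frac1{n_3}=\frac{J_2}{L(6m+k)(24m+1)}$. *)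

theory Defs
  imports Complex_Main
begin

definition erdos_straus_solution :: "nat \<Rightarrow> nat \<Rightarrow> nat \<Rightarrow> nat \<Rightarrow> bool" where
  "erdos_straus_solution n n1 n2 n3 \<longleftrightarrow>
     n1 > 0 \<and> n2 > 0 \<and> n3 > 0 \<and>
     4 / real n = 1 / real n1 + 1 / real n2 + 1 / real n3"

text \<open>
  The subtraction in \<open>4 * k - 1\<close> is on natural numbers; it is exact because \<open>k \<ge> 1\<close>.
  \<open>L\<close> is the multiplier and \<open>J1\<close>, \<open>J2\<close> are the numerator summands.
\<close>

definition wild_solution :: "nat \<Rightarrow> nat \<Rightarrow> nat \<Rightarrow> nat \<Rightarrow> bool" where
  "wild_solution m n1 n2 n3 \<longleftrightarrow>
     erdos_straus_solution (24 * m + 1) n1 n2 n3 \<and>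
     (\<exists>k. 1 \<le> k \<and> k \<le> 12 * m \<and> n1 = 6 * m + k \<and>
       (\<exists>L J1 J2. L \<ge> 2 \<and> J1 > 0 \<and> J2 > 0 \<and>
          J1 + J2 = L * (4 * k - 1) \<and>
          gcd L (gcd J1 J2) = 1 \<and>
          1 / real n2 = real J1 / real (L * (6 * m + k) * (24 * m + 1)) \<and>
          1 / real n3 = real J2 / real (L * (6 * m + k) * (24 * m + 1))))"

end

theory Submission
  imports Defs
begin

text \<open>
  All five families are wild solutions with \<open>k = 6\<close>, so that \<open>4 * k - 1 = 23\<close>. In each of
  them \<open>m + 1 = (c + 1) * q\<close>, and the multiplier \<open>L\<close> and the numerator summands come from a
  relation \<open>23 * L = J1 + J2\<close> in which both \<open>J1\<close> and \<open>J2\<close> divide \<open>6 * L * q\<close>: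
  \<open>{J1, J2} = {3 * q, 1}\<close> in case (1), \<open>{q, 1}\<close> in cases (2) and (3), and \<open>{q, 3}\<close> in
  cases (4) and (5).
\<close>

text \<open>With \<open>x = 6 * m + k\<close> and \<open>N = 24 * m + 1\<close> one has
  \<open>4 * x - N = 4 * k - 1\<close>, so \<open>4/N - 1/x = (4 * k - 1)/(x * N)\<close>; expanding
  by \<open>L\<close> and splitting the numerator into \<open>J1 + J2\<close> gives the two
  remaining fractions. The conditions on \<open>n2\<close> and \<open>n3\<close> are free of
  division, so an application needs only arithmetic in \<open>nat\<close>.\<close>

lemma wild_solutionI:
  fixes m k L J1 J2 n2 n3 :: nat
  assumes k: "1 \<le> k" "k \<le> 12 * m"
    and L: "L \<ge> 2"
    and J: "J1 > 0" "J2 > 0" "J1 + J2 = L * (4 * k - 1)" "gcd L (gcd J1 J2) = 1"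
    and n2: "n2 * J1 = L * (6 * m + k) * (24 * m + 1)"
    and n3: "n3 * J2 = L * (6 * m + k) * (24 * m + 1)"
  shows "wild_solution m (6 * m + k) n2 n3"
proof -
  define D where "D = L * (6 * m + k) * (24 * m + 1)"
  have D: "D > 0"
    using k L by (simp add: D_def)
  have pos: "n2 > 0" "n3 > 0"
    using D n2 n3 by (metis D_def mult_0 neq0_conv)+
  have quot: "1 / real n = real J / real D" if "n * J = D" for n J
    using D unfolding that[symmetric] by (simp add: divide_simps)
  have inv: "1 / real n2 = real J1 / real D" "1 / real n3 = real J2 / real D"
    by (fact quot[OF n2[folded D_def]] quot[OF n3[folded D_def]])+
  have sum: "1 / real n2 + 1 / real n3 = real (L * (4 * k - 1)) / real D"
    unfolding inv J(3)[symmetric] by (simp add: add_divide_distrib)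
  \<comment> \<open>This puts the numerator into the shape \<open>4 * x - N\<close> required by
    \<open>split\<close>; \<open>k \<ge> 1\<close> makes the natural subtraction exact.\<close>
  have M: "real (4 * k - 1) = 4 * real (6 * m + k) - real (24 * m + 1)"
    using k by (simp add: of_nat_diff)
  have split: "4 / N = 1 / x + l * (4 * x - N) / (l * x * N)"
    if "l > 0" "x > 0" "N > 0" for l x N :: real
    using that by (simp add: field_simps)
  have "4 / real (24 * m + 1) = 1 / real (6 * m + k) + real (L * (4 * k - 1)) / real D"
    unfolding D_def of_nat_mult M by (rule split) (use k L in auto)
  also have "\<dots> = 1 / real (6 * m + k) + 1 / real n2 + 1 / real n3"
    unfolding sum[symmetric] by (rule add.assoc[symmetric])
  finally have "erdos_straus_solution (24 * m + 1) (6 * m + k) n2 n3"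
    using pos k unfolding erdos_straus_solution_def by auto
  thus ?thesis
    unfolding wild_solution_def
    by (intro conjI exI[of _ k] exI[of _ L] exI[of _ J1] exI[of _ J2])
       (use k L J inv[unfolded D_def] in \<open>simp_all only:\<close>)
qed

lemma wild_solution_identity:
  "wild_solution m n1 n2 n3 \<Longrightarrow>
     4 / real (24 * m + 1) = 1 / real n1 + 1 / real n2 + 1 / real n3"
  by (simp add: wild_solution_def erdos_straus_solution_def)

text \<open>Since \<open>6 * m + 6 = 6 * (c + 1) * q\<close>, the factor
  \<open>(c + 1) * (24 * m + 1)\<close> cancels from both denominator conditions. What remains
  involves neither \<open>m\<close> nor \<open>c\<close>: the cofactors \<open>a\<close>,
  \<open>b\<close> of \<open>J1\<close>, \<open>J2\<close> in \<open>6 * L * q\<close>.\<close>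

lemma wild_solution_6I:
  fixes m c q L J1 J2 a b :: nat
  assumes "m > 0" and m: "m + 1 = (c + 1) * q"
    and "L \<ge> 2" "J1 > 0" "J2 > 0" "J1 + J2 = 23 * L" "gcd L (gcd J1 J2) = 1"
    and a: "a * J1 = 6 * L * q" and b: "b * J2 = 6 * L * q"
    and "n2 = a * (c + 1) * (24 * m + 1)" "n3 = b * (c + 1) * (24 * m + 1)"
  shows "4 / real (24 * m + 1) = 1 / real (6 * m + 6) + 1 / real n2 + 1 / real n3 \<and>
         wild_solution m (6 * m + 6) n2 n3"
proof -
  have eq: "d * (c + 1) * (24 * m + 1) * J = L * (6 * m + 6) * (24 * m + 1)"
    if "d * J = 6 * L * q" for d J
  proof -
    have "d * (c + 1) * (24 * m + 1) * J = (d * J) * (c + 1) * (24 * m + 1)"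
      by (simp only: ac_simps)
    also have "\<dots> = 6 * L * ((c + 1) * q) * (24 * m + 1)"
      unfolding that by (simp only: ac_simps)
    also have "\<dots> = L * (6 * m + 6) * (24 * m + 1)"
      unfolding m[symmetric] by (simp add: algebra_simps)
    finally show ?thesis .
  qed
  \<comment> \<open>Unification sets \<open>k = 6\<close>; the bound \<open>6 \<le> 12 * m\<close>
    follows from \<open>m > 0\<close>.\<close>
  have "wild_solution m (6 * m + 6) n2 n3"
    by (rule wild_solutionI[where L = L and ?J1.0 = J1 and ?J2.0 = J2])
       (use assms eq[OF a] eq[OF b] in simp_all)
  thus ?thesis
    using wild_solution_identity by blast
qed

theorem theorem4p1:
  fixes m :: nat
  assumes "m > 0"
  shows
    "(\<forall>r c :: nat. m = 46 * r + 14 + c * (46 * r + 15) \<longrightarrow>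
        4 / real (24 * m + 1) = 1 / real (6 * m + 6)
          + 1 / real (4 * (3 * r + 1) * (c + 1) * (24 * m + 1))
          + 1 / real (12 * (3 * r + 1) * (c + 1) * (46 * r + 15) * (24 * m + 1)) \<and>
        wild_solution m (6 * m + 6)
          (4 * (3 * r + 1) * (c + 1) * (24 * m + 1))
          (12 * (3 * r + 1) * (c + 1) * (46 * r + 15) * (24 * m + 1))) \<and>
     (\<forall>r c :: nat. r > 0 \<longrightarrow> m = 138 * r - 2 + c * (138 * r - 1) \<longrightarrow>
        4 / real (24 * m + 1) = 1 / real (6 * m + 6)
          + 1 / real (36 * r * (c + 1) * (24 * m + 1))
          + 1 / real (36 * r * (c + 1) * (138 * r - 1) * (24 * m + 1)) \<and>
        wild_solution m (6 * m + 6)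
          (36 * r * (c + 1) * (24 * m + 1))
          (36 * r * (c + 1) * (138 * r - 1) * (24 * m + 1))) \<and>
     (\<forall>r c :: nat. m = 138 * r + 90 + c * (138 * r + 91) \<longrightarrow>
        4 / real (24 * m + 1) = 1 / real (6 * m + 6)
          + 1 / real (12 * (3 * r + 2) * (c + 1) * (24 * m + 1))
          + 1 / real (12 * (3 * r + 2) * (c + 1) * (138 * r + 91) * (24 * m + 1)) \<and>
        wild_solution m (6 * m + 6)
          (12 * (3 * r + 2) * (c + 1) * (24 * m + 1))
          (12 * (3 * r + 2) * (c + 1) * (138 * r + 91) * (24 * m + 1))) \<and>
     (\<forall>r c :: nat. m = 138 * r + 42 + c * (138 * r + 43) \<longrightarrow>
        4 / real (24 * m + 1) = 1 / real (6 * m + 6)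
          + 1 / real (12 * (3 * r + 1) * (c + 1) * (24 * m + 1))
          + 1 / real (4 * (3 * r + 1) * (c + 1) * (138 * r + 43) * (24 * m + 1)) \<and>
        wild_solution m (6 * m + 6)
          (12 * (3 * r + 1) * (c + 1) * (24 * m + 1))
          (4 * (3 * r + 1) * (c + 1) * (138 * r + 43) * (24 * m + 1))) \<and>
     (\<forall>r c :: nat. m = 138 * r + 88 + c * (138 * r + 89) \<longrightarrow>
        4 / real (24 * m + 1) = 1 / real (6 * m + 6)
          + 1 / real (12 * (3 * r + 2) * (c + 1) * (24 * m + 1))
          + 1 / real (4 * (3 * r + 2) * (c + 1) * (138 * r + 89) * (24 * m + 1)) \<and>
        wild_solution m (6 * m + 6)
          (12 * (3 * r + 2) * (c + 1) * (24 * m + 1))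
          (4 * (3 * r + 2) * (c + 1) * (138 * r + 89) * (24 * m + 1)))"
\<comment> \<open>Only conjunctions with a universal left conjunct are split, so each identity stays
  paired with its \<open>wild_solution\<close> claim, as in \<open>wild_solution_6I\<close>.\<close>
proof (intro conjI[of "All _"] allI impI)
  fix r c :: nat
  assume m: "m = 46 * r + 14 + c * (46 * r + 15)"
  show "4 / real (24 * m + 1) = 1 / real (6 * m + 6)
          + 1 / real (4 * (3 * r + 1) * (c + 1) * (24 * m + 1))
          + 1 / real (12 * (3 * r + 1) * (c + 1) * (46 * r + 15) * (24 * m + 1)) \<and>
        wild_solution m (6 * m + 6)
          (4 * (3 * r + 1) * (c + 1) * (24 * m + 1))
          (12 * (3 * r + 1) * (c + 1) * (46 * r + 15) * (24 * m + 1))"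
    \<comment> \<open>Here \<open>23 * L = 138 * r + 46 = 3 * q + 1\<close>, with cofactors
      \<open>a = 2 * L\<close> and \<open>b = 6 * L * q\<close>.\<close>
    by (rule wild_solution_6I[where q = "46 * r + 15" and c = c and L = "6 * r + 2"
          and ?J1.0 = "3 * (46 * r + 15)" and ?J2.0 = 1
          and a = "4 * (3 * r + 1)" and b = "12 * (3 * r + 1) * (46 * r + 15)"])
       (use assms m in \<open>simp_all add: algebra_simps\<close>)
next
  fix r c :: nat
  assume r: "r > 0" and m: "m = 138 * r - 2 + c * (138 * r - 1)"
  show "4 / real (24 * m + 1) = 1 / real (6 * m + 6)
          + 1 / real (36 * r * (c + 1) * (24 * m + 1))
          + 1 / real (36 * r * (c + 1) * (138 * r - 1) * (24 * m + 1)) \<and>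
        wild_solution m (6 * m + 6)
          (36 * r * (c + 1) * (24 * m + 1))
          (36 * r * (c + 1) * (138 * r - 1) * (24 * m + 1))"
    \<comment> \<open>Here \<open>23 * L = 138 * r = q + 1\<close> and \<open>a = 6 * L\<close>;
      \<open>r > 0\<close> makes the subtractions exact and gives \<open>L \<ge> 2\<close>.\<close>
    by (rule wild_solution_6I[where q = "138 * r - 1" and c = c and L = "6 * r"
          and ?J1.0 = "138 * r - 1" and ?J2.0 = 1
          and a = "36 * r" and b = "36 * r * (138 * r - 1)"])
       (use assms m r in \<open>simp_all add: algebra_simps\<close>)
next
  fix r c :: nat
  assume m: "m = 138 * r + 90 + c * (138 * r + 91)"
  show "4 / real (24 * m + 1) = 1 / real (6 * m + 6)
          + 1 / real (12 * (3 * r + 2) * (c + 1) * (24 * m + 1))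
          + 1 / real (12 * (3 * r + 2) * (c + 1) * (138 * r + 91) * (24 * m + 1)) \<and>
        wild_solution m (6 * m + 6)
          (12 * (3 * r + 2) * (c + 1) * (24 * m + 1))
          (12 * (3 * r + 2) * (c + 1) * (138 * r + 91) * (24 * m + 1))"
    \<comment> \<open>Again \<open>23 * L = 138 * r + 92 = q + 1\<close> and
      \<open>a = 6 * L\<close>.\<close>
    by (rule wild_solution_6I[where q = "138 * r + 91" and c = c and L = "6 * r + 4"
          and ?J1.0 = "138 * r + 91" and ?J2.0 = 1
          and a = "12 * (3 * r + 2)" and b = "12 * (3 * r + 2) * (138 * r + 91)"])
       (use assms m in \<open>simp_all add: algebra_simps\<close>)
next
  fix r c :: nat
  assume m: "m = 138 * r + 42 + c * (138 * r + 43)"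
  \<comment> \<open>With \<open>J2 = 3\<close> the gcd condition is no longer immediate; it follows
    from \<open>L\<close> being prime to 3.\<close>
  have "(6 * r + 2) mod 3 = 2"
    by presburger
  hence "gcd (6 * r + 2) 3 = 1"
    by (subst gcd_red_nat) (simp add: gcd_non_0_nat)
  hence gcd: "gcd (6 * r + 2) (gcd (138 * r + 43) 3) = 1"
    by (metis gcd.left_commute gcd_1_nat gcd.commute)
  show "4 / real (24 * m + 1) = 1 / real (6 * m + 6)
          + 1 / real (12 * (3 * r + 1) * (c + 1) * (24 * m + 1))
          + 1 / real (4 * (3 * r + 1) * (c + 1) * (138 * r + 43) * (24 * m + 1)) \<and>
        wild_solution m (6 * m + 6)
          (12 * (3 * r + 1) * (c + 1) * (24 * m + 1))
          (4 * (3 * r + 1) * (c + 1) * (138 * r + 43) * (24 * m + 1))"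
    \<comment> \<open>Here \<open>23 * L = 138 * r + 46 = q + 3\<close>, so \<open>a = 6 * L\<close>
      and \<open>b = 2 * L * q\<close>.\<close>
    by (rule wild_solution_6I[where q = "138 * r + 43" and c = c and L = "6 * r + 2"
          and ?J1.0 = "138 * r + 43" and ?J2.0 = 3
          and a = "12 * (3 * r + 1)" and b = "4 * (3 * r + 1) * (138 * r + 43)"])
       (use assms m gcd in \<open>simp_all add: algebra_simps\<close>)
next
  fix r c :: nat
  assume m: "m = 138 * r + 88 + c * (138 * r + 89)"
  have "(6 * r + 4) mod 3 = 1"
    by presburger
  hence "gcd (6 * r + 4) 3 = 1"
    by (subst gcd_red_nat) (simp add: gcd_non_0_nat)
  hence gcd: "gcd (6 * r + 4) (gcd (138 * r + 89) 3) = 1"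
    by (metis gcd.left_commute gcd_1_nat gcd.commute)
  show "4 / real (24 * m + 1) = 1 / real (6 * m + 6)
          + 1 / real (12 * (3 * r + 2) * (c + 1) * (24 * m + 1))
          + 1 / real (4 * (3 * r + 2) * (c + 1) * (138 * r + 89) * (24 * m + 1)) \<and>
        wild_solution m (6 * m + 6)
          (12 * (3 * r + 2) * (c + 1) * (24 * m + 1))
          (4 * (3 * r + 2) * (c + 1) * (138 * r + 89) * (24 * m + 1))"
    \<comment> \<open>Here \<open>23 * L = 138 * r + 92 = q + 3\<close>, with
      \<open>a = 6 * L\<close> and \<open>b = 2 * L * q\<close> once more.\<close>
    by (rule wild_solution_6I[where q = "138 * r + 89" and c = c and L = "6 * r + 4"
          and ?J1.0 = "138 * r + 89" and ?J2.0 = 3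
          and a = "12 * (3 * r + 2)" and b = "4 * (3 * r + 2) * (138 * r + 89)"])
       (use assms m gcd in \<open>simp_all add: algebra_simps\<close>)
qed

end
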